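(* Let $G$ be a finite simple graph with at least one vertex, $K$ a field and $S=K[x_v : v\in V(G)]$. (a) The multiplicity $e(S/NI(G))$ equals the number of minimal dominating sets of $G$ of cardinality $\gamma(G)$. In particular $e(S/NI(G))\leq d(G)$, with equality if and only if $G$ is well-dominated. (b) If $V(G)$ is the disjoint union of maximal cliques $C_1,\ldots,C_r$ of $G$, each of which contains a free vertex, then $e(S/NI(G))=d(G)=\prod_{i=1}^r |C_i|$. In particular this holds when $G$ is a well-covered chordal graph or a whisker graph.
   Context: $N_G[v]$ is the closed neighborhood of $v$ and $NI(G)=\big(\prod_{w\in N_G[v]} x_w : v\in V(G)\big)$ is the closed neighborhood ideal. A dominating set is a set $D\subseteq V(G)$ with $D\cap N_G[v]\neq\emptyset$ for all $v$; minimal means no proper subset is dominating. $\gamma(G)$ is the minimum size of a dominating set; $d(G)$ is the number of minimal dominating sets of $G$. $G$ is well-dominated if all minimal dominating sets have the same size, and well-covered if all maximal independent sets have the same size. A clique is a set of pairwise adjacent vertices; a free vertex is a vertex lying in exactly one maximal clique. A whisker graph is a graph in which every vertex either has degree one or has a unique neighbor of degree one. $e(R)$ denotes the multiplicity of a standard graded ring $R$. $K$ is an infinite field. *)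

theory Defs
  imports "HOL-Analysis.Analysis" "HOL-Library.Poly_Mapping"
begin

text \<open>Finite simple graphs: the vertex set is the (finite, nonempty) universe of a type 'v
  of class finite; adjacency is a symmetric irreflexive relation E.\<close>

definition simple_graph :: "('v \<Rightarrow> 'v \<Rightarrow> bool) \<Rightarrow> bool" where
  "simple_graph E \<longleftrightarrow> (\<forall>u v. E u v \<longrightarrow> E v u) \<and> (\<forall>v. \<not> E v v)"

definition closed_nbhd :: "('v \<Rightarrow> 'v \<Rightarrow> bool) \<Rightarrow> 'v \<Rightarrow> 'v set" where
  "closed_nbhd E v = {w. w = v \<or> E v w}"

definition dominating :: "('v \<Rightarrow> 'v \<Rightarrow> bool) \<Rightarrow> 'v set \<Rightarrow> bool" where
  "dominating E D \<longleftrightarrow> (\<forall>v. D \<inter> closed_nbhd E v \<noteq> {})"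

definition min_dominating :: "('v \<Rightarrow> 'v \<Rightarrow> bool) \<Rightarrow> 'v set \<Rightarrow> bool" where
  "min_dominating E D \<longleftrightarrow> dominating E D \<and> (\<forall>D'. D' \<subset> D \<longrightarrow> \<not> dominating E D')"

definition domination_number :: "('v::finite \<Rightarrow> 'v \<Rightarrow> bool) \<Rightarrow> nat" where
  "domination_number E = Min (card ` {D. dominating E D})"

definition num_min_dom :: "('v::finite \<Rightarrow> 'v \<Rightarrow> bool) \<Rightarrow> nat" where
  "num_min_dom E = card {D. min_dominating E D}"

definition well_dominated :: "('v \<Rightarrow> 'v \<Rightarrow> bool) \<Rightarrow> bool" where
  "well_dominated E \<longleftrightarrow>
     (\<forall>D D'. min_dominating E D \<and> min_dominating E D' \<longrightarrow> card D = card D')"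

definition clique :: "('v \<Rightarrow> 'v \<Rightarrow> bool) \<Rightarrow> 'v set \<Rightarrow> bool" where
  "clique E C \<longleftrightarrow> (\<forall>u\<in>C. \<forall>v\<in>C. u \<noteq> v \<longrightarrow> E u v)"

definition max_clique :: "('v \<Rightarrow> 'v \<Rightarrow> bool) \<Rightarrow> 'v set \<Rightarrow> bool" where
  "max_clique E C \<longleftrightarrow> clique E C \<and> (\<forall>C'. clique E C' \<and> C \<subseteq> C' \<longrightarrow> C' = C)"

definition free_vertex :: "('v \<Rightarrow> 'v \<Rightarrow> bool) \<Rightarrow> 'v \<Rightarrow> bool" where
  "free_vertex E v \<longleftrightarrow> (\<exists>!C. max_clique E C \<and> v \<in> C)"

definition indep_set :: "('v \<Rightarrow> 'v \<Rightarrow> bool) \<Rightarrow> 'v set \<Rightarrow> bool" where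
  "indep_set E S \<longleftrightarrow> (\<forall>u\<in>S. \<forall>v\<in>S. \<not> E u v)"

definition max_indep_set :: "('v \<Rightarrow> 'v \<Rightarrow> bool) \<Rightarrow> 'v set \<Rightarrow> bool" where
  "max_indep_set E S \<longleftrightarrow> indep_set E S \<and> (\<forall>S'. indep_set E S' \<and> S \<subseteq> S' \<longrightarrow> S' = S)"

definition well_covered :: "('v \<Rightarrow> 'v \<Rightarrow> bool) \<Rightarrow> bool" where
  "well_covered E \<longleftrightarrow>
     (\<forall>S S'. max_indep_set E S \<and> max_indep_set E S' \<longrightarrow> card S = card S')"

definition chordal :: "('v \<Rightarrow> 'v \<Rightarrow> bool) \<Rightarrow> bool" where
  "chordal E \<longleftrightarrow>
    (\<forall>xs. distinct xs \<and> length xs \<ge> 4 \<and>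
          (\<forall>i<length xs. E (xs ! i) (xs ! ((i + 1) mod length xs)))
      \<longrightarrow> (\<exists>i<length xs. \<exists>j<length xs. i \<noteq> j \<and> j \<noteq> (i + 1) mod length xs
             \<and> i \<noteq> (j + 1) mod length xs \<and> E (xs ! i) (xs ! j)))"

definition degree :: "('v \<Rightarrow> 'v \<Rightarrow> bool) \<Rightarrow> 'v \<Rightarrow> nat" where
  "degree E v = card {w. E v w}"

definition whisker_graph :: "('v \<Rightarrow> 'v \<Rightarrow> bool) \<Rightarrow> bool" where
  "whisker_graph E \<longleftrightarrow>
     (\<forall>v. degree E v = 1 \<or> (\<exists>!w. E v w \<and> degree E w = 1))"

type_synonym ('v, 'k) mpoly = "('v \<Rightarrow>\<^sub>0 nat) \<Rightarrow>\<^sub>0 'k"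

definition sc :: "'k::field \<Rightarrow> ('v, 'k) mpoly \<Rightarrow> ('v, 'k) mpoly" where
  "sc c p = Poly_Mapping.map (\<lambda>a. c * a) p"

definition mon_deg :: "('v \<Rightarrow>\<^sub>0 nat) \<Rightarrow> nat" where
  "mon_deg m = (\<Sum>v\<in>Poly_Mapping.keys m. Poly_Mapping.lookup m v)"

definition homog :: "nat \<Rightarrow> ('v, 'k::field) mpoly set" where
  "homog d = {p. \<forall>m\<in>Poly_Mapping.keys p. mon_deg m = d}"

definition NI_gen :: "('v::finite \<Rightarrow> 'v \<Rightarrow> bool) \<Rightarrow> 'v \<Rightarrow> ('v, 'k::field) mpoly" where
  "NI_gen E v = Poly_Mapping.single (\<Sum>w\<in>closed_nbhd E v. Poly_Mapping.single w 1) 1"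

definition NI :: "('v::finite \<Rightarrow> 'v \<Rightarrow> bool) \<Rightarrow> ('v, 'k::field) mpoly set" where
  "NI E = {p. \<exists>c. p = (\<Sum>v\<in>UNIV. c v * NI_gen E v)}"

definition hilbert_fun :: "'k::field itself \<Rightarrow> ('v::finite \<Rightarrow> 'v \<Rightarrow> bool) \<Rightarrow> nat \<Rightarrow> nat" where
  "hilbert_fun TYPE('k) E d =
     vector_space.dim (sc :: 'k \<Rightarrow> _) (homog d :: ('v,'k) mpoly set)
     - vector_space.dim (sc :: 'k \<Rightarrow> _) ((homog d :: ('v,'k) mpoly set) \<inter> (NI E :: ('v,'k) mpoly set))"

text \<open>Multiplicity of the standard graded ring S/NI(G) via the Hilbert-Samuel function:
  sum_{i<=d} H(i) ~ e d^delta / delta!, where delta is the Krull dimension.\<close>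
definition multiplicity :: "'k::field itself \<Rightarrow> ('v::finite \<Rightarrow> 'v \<Rightarrow> bool) \<Rightarrow> real" where
  "multiplicity TYPE('k) E =
     (THE e. e > 0 \<and> (\<exists>\<delta>::nat.
        ((\<lambda>d. fact \<delta> * (\<Sum>i\<le>d. real (hilbert_fun TYPE('k) E i)) / real d ^ \<delta>)
          \<longlongrightarrow> e) sequentially))"

end

theory Submission
  imports Defs
begin

text \<open>A monomial lies outside \<open>NI(G)\<close> iff the set of variables missing from it is dominating.
  Sorting the monomials outside \<open>NI(G)\<close> by this set \<open>D\<close>, there are \<open>d choose (n - |D|)\<close> of degree
  at most \<open>d\<close> for each \<open>D\<close>, so the leading term comes from the dominating sets of minimum size.

  If maximal cliques with free vertices partition the vertices, then the neighbourhoods of the free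
  vertices are these cliques, so the minimal dominating sets are the transversals of the partition.

  In a well-covered chordal graph the parts are the closed neighbourhoods of simplicial vertices.
  They are disjoint because a common vertex could be exchanged for two simplicial ones in an
  independent set. If they do not cover, take a simplicial vertex \<open>w\<close> of the uncovered part, with
  clique \<open>Q\<close> of uncovered neighbours: a maximal independent set that dominates \<open>Q\<close> from outside is
  smaller than the one obtained by adding \<open>w\<close> to its uncovered part and choosing a
  simplicial vertex from every part.\<close>

subsection \<open>Multiplicity\<close>

lemma lookup_sc [simp]: "Poly_Mapping.lookup (sc c p) m = c * Poly_Mapping.lookup p m"
  by (simp add: sc_def map.rep_eq when_def)

lemma vector_space_sc: "vector_space (sc :: 'k::field \<Rightarrow> ('v, 'k) mpoly \<Rightarrow> _)"
  by unfold_locales (auto intro!: poly_mapping_eqI simp: lookup_add algebra_simps)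

interpretation mp: vector_space "sc :: 'k::field \<Rightarrow> ('v, 'k) mpoly \<Rightarrow> _"
  by (rule vector_space_sc)

lemma poly_mapping_eq_sum_single:
  assumes "finite T" "Poly_Mapping.keys p \<subseteq> T"
  shows "p = (\<Sum>m\<in>T. Poly_Mapping.single m (Poly_Mapping.lookup p m))"
  using assms
  by (intro poly_mapping_eqI)
    (auto simp: lookup_sum lookup_single when_def in_keys_iff)

text \<open>The monomials in \<open>T\<close>, taken with coefficient 1, form a basis. Both
  \<open>homog d\<close> and its intersection with \<open>NI E\<close> have this shape, so their
  dimensions become counts of monomials.\<close>

lemma dim_keys_subset:
  fixes T :: "('v \<Rightarrow>\<^sub>0 nat) set"
  assumes "finite T"
  shows "vector_space.dim (sc :: 'k::field \<Rightarrow> ('v, 'k) mpoly \<Rightarrow> _) {p. Poly_Mapping.keys p \<subseteq> T} = card T"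
proof -
  let ?e = "\<lambda>m. Poly_Mapping.single m 1 :: ('v, 'k) mpoly"
  have inj: "inj_on ?e T"
    by (rule inj_onI) (metis lookup_single_eq lookup_single_not_eq zero_neq_one)
  have sce: "sc a (?e m) = Poly_Mapping.single m a" for a m
    by (intro poly_mapping_eqI) (auto simp: lookup_single when_def)
  have "mp.independent (?e ` T)"
  proof (rule mp.independent_if_scalars_zero)
    fix f :: "('v, 'k) mpoly \<Rightarrow> 'k" and x
    assume *: "(\<Sum>x\<in>?e ` T. sc (f x) x) = 0" and "x \<in> ?e ` T"
    then obtain m where m: "m \<in> T" "x = ?e m" by blast
    have "(\<Sum>m\<in>T. Poly_Mapping.single m (f (?e m))) = 0"
      using * by (simp add: sum.reindex[OF inj] sce)
    then have "(\<Sum>m'\<in>T. Poly_Mapping.lookup (Poly_Mapping.single m' (f (?e m'))) m) = 0"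
      by (metis lookup_sum lookup_zero)
    then show "f x = 0" using m assms by (simp add: lookup_single when_def)
  qed (use assms in simp)
  moreover have "?e ` T \<subseteq> {p. Poly_Mapping.keys p \<subseteq> T}" by auto
  moreover have "{p. Poly_Mapping.keys p \<subseteq> T} \<subseteq> mp.span (?e ` T)"
  proof safe
    fix p :: "('v, 'k) mpoly" assume "Poly_Mapping.keys p \<subseteq> T"
    then have "p = (\<Sum>m\<in>T. sc (Poly_Mapping.lookup p m) (?e m))"
      using poly_mapping_eq_sum_single[OF assms] by (simp add: sce)
    also have "\<dots> \<in> mp.span (?e ` T)"
      by (intro mp.span_sum mp.span_scale mp.span_base) auto
    finally show "p \<in> mp.span (?e ` T)" .
  qed
  ultimately show ?thesis
    using mp.basis_card_eq_dim[of "?e ` T" "{p. Poly_Mapping.keys p \<subseteq> T}"] card_image[OF inj]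
    by simp
qed

section \<open>Degrees of monomials and counting by support\<close>

lemma mon_deg_eq_sum_UNIV: "mon_deg (m :: 'v::finite \<Rightarrow>\<^sub>0 nat) = (\<Sum>v\<in>UNIV. Poly_Mapping.lookup m v)"
  unfolding mon_deg_def by (rule sum.mono_neutral_left) (auto simp: in_keys_iff)

lemma mon_deg_add: "mon_deg (a + b :: 'v::finite \<Rightarrow>\<^sub>0 nat) = mon_deg a + mon_deg b"
  by (simp add: mon_deg_eq_sum_UNIV lookup_add sum.distrib)

lemma mon_deg_single: "mon_deg (Poly_Mapping.single (v :: 'v::finite) j) = j"
  by (simp add: mon_deg_eq_sum_UNIV lookup_single when_def)

lemma finite_mon_deg_le: "finite {m :: 'v::finite \<Rightarrow>\<^sub>0 nat. mon_deg m \<le> d}"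
proof -
  have "Poly_Mapping.lookup ` {m :: 'v \<Rightarrow>\<^sub>0 nat. mon_deg m \<le> d} \<subseteq> UNIV \<rightarrow>\<^sub>E {..d}"
    by (auto simp: mon_deg_eq_sum_UNIV) (metis UNIV_I finite le_trans member_le_sum zero_le)
  then have "finite (Poly_Mapping.lookup ` {m :: 'v \<Rightarrow>\<^sub>0 nat. mon_deg m \<le> d})"
    by (rule finite_subset) (simp add: finite_PiE)
  then show ?thesis
    by (rule finite_imageD) (simp add: inj_on_def poly_mapping_eqI)
qed

lemma mon_deg_eq_0_iff: "mon_deg (m :: 'v::finite \<Rightarrow>\<^sub>0 nat) = 0 \<longleftrightarrow> Poly_Mapping.keys m = {}"
proof -
  have "mon_deg m = 0 \<longleftrightarrow> (\<forall>v\<in>Poly_Mapping.keys m. Poly_Mapping.lookup m v = 0)"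
    by (simp add: mon_deg_def)
  then show ?thesis by (metis all_not_in_conv in_keys_iff)
qed

text \<open>This is Pascal's rule: dividing a monomial of support \<open>insert a A\<close> by the
  variable of \<open>a\<close> lowers its degree by one and leaves support \<open>A\<close> or
  \<open>insert a A\<close>. An induction on \<open>d\<close> is nested in the induction on the
  support.\<close>

lemma card_mon_keys_deg_le:
  fixes A :: "'v::finite set"
  shows "card {m. Poly_Mapping.keys m = A \<and> mon_deg m \<le> d} = d choose card A"
proof (induction A arbitrary: d rule: finite_induct[OF finite])
  case 1
  have "{m :: 'v \<Rightarrow>\<^sub>0 nat. Poly_Mapping.keys m = {} \<and> mon_deg m \<le> d} = {0}"
    by (auto simp: mon_deg_def)
  then show ?case by simp
next
  case (2 a A)
  let ?M = "\<lambda>A d. {m :: 'v \<Rightarrow>\<^sub>0 nat. Poly_Mapping.keys m = A \<and> mon_deg m \<le> d}"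
  show ?case
  proof (induction d)
    case 0
    have "?M (insert a A) 0 = {}" by (auto simp: mon_deg_eq_0_iff simp del: keys_eq_empty)
    then show ?case using 2 by (simp only:) simp
  next
    case (Suc d)
    let ?s = "Poly_Mapping.single a (1::nat)"
    have "?M (insert a A) (Suc d) = (\<lambda>m. m + ?s) ` (?M A d \<union> ?M (insert a A) d)" (is "?L = ?R")
    proof (intro equalityI subsetI)
      fix m assume m: "m \<in> ?L"
      then have "Poly_Mapping.lookup m a \<ge> 1" by (auto simp: in_keys_iff Suc_le_eq)
      then have eq: "m = (m - ?s) + ?s"
        by (intro poly_mapping_eqI) (auto simp: lookup_add lookup_minus lookup_single when_def)
      have "Poly_Mapping.keys (m - ?s) - {a} = Poly_Mapping.keys m - {a}"
        by (auto simp: in_keys_iff lookup_minus lookup_single when_def)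
      then have "Poly_Mapping.keys (m - ?s) = A \<or> Poly_Mapping.keys (m - ?s) = insert a A"
        using m \<open>a \<notin> A\<close> by auto
      moreover have "mon_deg (m - ?s) + 1 \<le> Suc d"
        using m eq mon_deg_add[of "m - ?s" ?s] by (simp add: mon_deg_single)
      ultimately show "m \<in> ?R" using eq by auto
    next
      fix m assume "m \<in> ?R"
      then obtain m' where m': "m = m' + ?s" "m' \<in> ?M A d \<union> ?M (insert a A) d" by blast
      have "Poly_Mapping.keys m = insert a (Poly_Mapping.keys m')"
        unfolding m' by (auto simp: in_keys_iff lookup_add lookup_single when_def split: if_splits)
      then show "m \<in> ?L" using m' by (auto simp: mon_deg_add mon_deg_single)
    qed
    moreover have "card ?R = card (?M A d \<union> ?M (insert a A) d)"
      by (rule card_image) (simp add: inj_on_def)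
    moreover have "card (?M A d \<union> ?M (insert a A) d) = card (?M A d) + card (?M (insert a A) d)"
      by (rule card_Un_disjoint)
        (use \<open>a \<notin> A\<close> in \<open>auto intro: finite_subset[OF _ finite_mon_deg_le[of d]]\<close>)
    ultimately show ?case
      using Suc 2 by simp
  qed
qed

section \<open>Membership in the closed neighborhood ideal\<close>

lemma lookup_sum_single_one:
  "Poly_Mapping.lookup (\<Sum>w\<in>(A :: 'v::finite set). Poly_Mapping.single w (1::nat)) u = (if u \<in> A then 1 else 0)"
  by (simp add: lookup_sum lookup_single when_def)

lemma NI_zero: "0 \<in> NI E"
  unfolding NI_def by (auto intro!: exI[of _ "\<lambda>_. 0"])

lemma NI_add: "p \<in> NI E \<Longrightarrow> q \<in> NI E \<Longrightarrow> p + q \<in> NI E"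
  unfolding NI_def
proof safe
  fix c c' :: "'a \<Rightarrow> ('a, 'b) mpoly"
  show "\<exists>c''. (\<Sum>v\<in>UNIV. c v * NI_gen E v) + (\<Sum>v\<in>UNIV. c' v * NI_gen E v)
    = (\<Sum>v\<in>UNIV. c'' v * NI_gen E v)"
    by (rule exI[of _ "\<lambda>v. c v + c' v"]) (simp add: sum.distrib distrib_right)
qed

lemma NI_sum: "(\<And>i. i \<in> I \<Longrightarrow> f i \<in> NI E) \<Longrightarrow> sum f I \<in> NI E"
  by (induction I rule: infinite_finite_induct) (auto intro: NI_zero NI_add)

lemma mult_NI_gen_in_NI: "c * NI_gen E v \<in> NI E"
  unfolding NI_def
  by (auto intro!: exI[of _ "\<lambda>u. if u = v then c else 0"] simp: if_distrib[of "\<lambda>x. x * _"] cong: if_cong)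

text \<open>In an ideal generated by monomials, membership is decided monomial by monomial. The
  generators are squarefree, so \<open>m\<close> is divisible by the generator of \<open>v\<close>
  exactly when its support contains N[v], that is, when the complement of the support misses
  N[v].\<close>

lemma mem_NI_iff:
  fixes p :: "('v::finite, 'k::field) mpoly"
  shows "p \<in> NI E \<longleftrightarrow> (\<forall>m\<in>Poly_Mapping.keys p. \<not> dominating E (- Poly_Mapping.keys m))"
    (is "_ \<longleftrightarrow> ?R")
proof
  let ?g = "\<lambda>v. \<Sum>w\<in>closed_nbhd E v. Poly_Mapping.single w (1::nat)"
  assume "p \<in> NI E"
  then obtain c where c: "p = (\<Sum>v\<in>UNIV. c v * NI_gen E v)" by (auto simp: NI_def)
  show ?R
  proof
    fix m assume "m \<in> Poly_Mapping.keys p"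
    then obtain v where "m \<in> Poly_Mapping.keys (c v * NI_gen E v)"
      unfolding c using keys_sum[of "\<lambda>v. c v * NI_gen E v" UNIV] by blast
    then obtain a where "m = a + ?g v"
      using keys_mult[of "c v" "NI_gen E v"] by (auto simp: NI_gen_def)
    then have "closed_nbhd E v \<subseteq> Poly_Mapping.keys m"
      by (auto simp: in_keys_iff lookup_add lookup_sum_single_one simp del: One_nat_def)
    then show "\<not> dominating E (- Poly_Mapping.keys m)" by (auto simp: dominating_def)
  qed
next
  let ?g = "\<lambda>v. \<Sum>w\<in>closed_nbhd E v. Poly_Mapping.single w (1::nat)"
  assume R: ?R
  have "Poly_Mapping.single m (Poly_Mapping.lookup p m) \<in> NI E" if m: "m \<in> Poly_Mapping.keys p" for m
  proof -
    obtain v where "closed_nbhd E v \<subseteq> Poly_Mapping.keys m"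
      using R m unfolding dominating_def by blast
    \<comment> \<open>The subtraction of exponents is truncated; it is exact here because every
      exponent of \<open>m\<close> on N[v] is at least 1.\<close>
    then have "m = (m - ?g v) + ?g v"
      by (intro poly_mapping_eqI)
        (auto simp: lookup_add lookup_minus lookup_sum_single_one in_keys_iff simp del: One_nat_def)
    then have "Poly_Mapping.single m (Poly_Mapping.lookup p m)
      = Poly_Mapping.single (m - ?g v) (Poly_Mapping.lookup p m) * NI_gen E v"
      by (simp add: NI_gen_def mult_single)
    then show ?thesis by (simp only: mult_NI_gen_in_NI)
  qed
  then have "(\<Sum>m\<in>Poly_Mapping.keys p. Poly_Mapping.single m (Poly_Mapping.lookup p m)) \<in> NI E"
    by (rule NI_sum)
  then show "p \<in> NI E"
    using poly_mapping_eq_sum_single[of "Poly_Mapping.keys p" p] by simp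
qed

section \<open>The Hilbert function and its partial sums\<close>

lemma hilbert_fun_eq:
  fixes E :: "'v::finite \<Rightarrow> 'v \<Rightarrow> bool"
  shows "hilbert_fun TYPE('k::field) E d
    = card {m :: 'v \<Rightarrow>\<^sub>0 nat. mon_deg m = d \<and> dominating E (- Poly_Mapping.keys m)}"
proof -
  let ?A = "{m :: 'v \<Rightarrow>\<^sub>0 nat. mon_deg m = d}"
  let ?B = "{m \<in> ?A. \<not> dominating E (- Poly_Mapping.keys m)}"
  have fin: "finite ?A" by (rule finite_subset[OF _ finite_mon_deg_le[of d]]) auto
  have 1: "(homog d :: ('v, 'k) mpoly set) = {p. Poly_Mapping.keys p \<subseteq> ?A}"
    by (auto simp: homog_def)
  have 2: "(homog d :: ('v, 'k) mpoly set) \<inter> NI E = {p. Poly_Mapping.keys p \<subseteq> ?B}"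
    by (auto simp: homog_def mem_NI_iff)
  have "hilbert_fun TYPE('k) E d = card ?A - card ?B"
    unfolding hilbert_fun_def 2 unfolding 1 using fin by (simp add: dim_keys_subset)
  also have "\<dots> = card (?A - ?B)" using fin by (subst card_Diff_subset) auto
  also have "?A - ?B = {m. mon_deg m = d \<and> dominating E (- Poly_Mapping.keys m)}" by auto
  finally show ?thesis .
qed

text \<open>The monomials of degree at most \<open>d\<close> outside the ideal are counted twice: by
  degree, and by the dominating set \<open>D\<close> that is the complement of their
  support.\<close>

lemma sum_hilbert_fun:
  fixes E :: "'v::finite \<Rightarrow> 'v \<Rightarrow> bool"
  shows "(\<Sum>i\<le>d. hilbert_fun TYPE('k::field) E i)
    = (\<Sum>D | dominating E D. d choose (CARD('v) - card D))"
proof -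
  let ?M = "\<lambda>i. {m :: 'v \<Rightarrow>\<^sub>0 nat. mon_deg m = i \<and> dominating E (- Poly_Mapping.keys m)}"
  let ?N = "\<lambda>D. {m :: 'v \<Rightarrow>\<^sub>0 nat. Poly_Mapping.keys m = - D \<and> mon_deg m \<le> d}"
  have "(\<Sum>i\<le>d. hilbert_fun TYPE('k::field) E i) = card (\<Union>i\<in>{..d}. ?M i)"
    unfolding hilbert_fun_eq
    by (rule card_UN_disjoint[symmetric])
      (auto intro: finite_subset[OF _ finite_mon_deg_le[of d]])
  also have "(\<Union>i\<in>{..d}. ?M i) = (\<Union>D\<in>{D. dominating E D}. ?N D)"
    by auto
  also have "card \<dots> = (\<Sum>D | dominating E D. card (?N D))"
    by (rule card_UN_disjoint)
      (auto intro: finite_subset[OF _ finite_mon_deg_le[of d]])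
  also have "\<dots> = (\<Sum>D | dominating E D. d choose (CARD('v) - card D))"
    by (simp add: card_mon_keys_deg_le card_Diff_subset Compl_eq_Diff_UNIV)
  finally show ?thesis .
qed

section \<open>Asymptotics of binomial coefficients\<close>

text \<open>The numerator is a product of \<open>k\<close> factors \<open>d - i\<close>, and each of
  them divided by \<open>d\<close> tends to 1.\<close>

lemma tendsto_choose_div_power:
  "(\<lambda>d. fact k * real (d choose k) / real d ^ k) \<longlonglongrightarrow> 1"
proof -
  \<comment> \<open>Since division by zero gives 0, \<open>real d / real d\<close> equals 1 only
    from \<open>d = 1\<close> on.\<close>
  have "(\<lambda>d. real d / real d - real i / real d) \<longlonglongrightarrow> 1 - 0" for i
    by (intro tendsto_diff lim_const_over_n)
      (rule tendsto_eventually, auto intro: eventually_sequentiallyI[of 1])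
  then have "(\<lambda>d. \<Prod>i=0..<k. (real d - real i) / real d) \<longlonglongrightarrow> (\<Prod>i=0..<k. 1)"
    by (intro tendsto_prod) (simp only: diff_divide_distrib diff_zero)
  then show ?thesis
    by (simp add: binomial_gbinomial gbinomial_prod_rev prod_dividef)
qed

lemma tendsto_choose_div_power_less:
  assumes "k < n"
  shows "(\<lambda>d. real (d choose k) / real d ^ n) \<longlonglongrightarrow> 0"
proof -
  have "(\<lambda>d. (fact k * real (d choose k) / real d ^ k) * (1 / real d ^ (n - k)) / fact k) \<longlonglongrightarrow> 1 * 0 / fact k"
  proof (intro tendsto_mult tendsto_divide tendsto_choose_div_power)
    show "(\<lambda>d. 1 / real d ^ (n - k)) \<longlonglongrightarrow> 0"
      using assms tendsto_power[OF lim_1_over_n, of "n - k"] by (simp add: power_divide zero_power)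
  qed auto
  then show ?thesis using assms by (simp add: power_add[symmetric])
qed

section \<open>Dominating sets of minimum size and the multiplicity\<close>

lemma domination_number_le: "dominating E D \<Longrightarrow> domination_number E \<le> card D"
  unfolding domination_number_def by (intro Min_le) auto

lemma domination_number_attained:
  fixes E :: "'v::finite \<Rightarrow> 'v \<Rightarrow> bool"
  shows "\<exists>D. dominating E D \<and> card D = domination_number E"
proof -
  have "dominating E UNIV" by (auto simp: dominating_def closed_nbhd_def)
  then have "domination_number E \<in> card ` {D. dominating E D}"
    unfolding domination_number_def by (intro Min_in) auto
  then show ?thesis by auto
qed

lemma min_dominating_card_eq_iff:
  fixes E :: "'v::finite \<Rightarrow> 'v \<Rightarrow> bool"
  assumes "card D = domination_number E"
  shows "min_dominating E D \<longleftrightarrow> dominating E D"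
  unfolding min_dominating_def using assms domination_number_le[of E]
  by (metis finite leD psubset_card_mono)

text \<open>Normalised with exponent \<open>n - \<gamma>\<close>, each dominating set of size
  \<open>\<gamma>\<close> contributes 1 to the limit and each larger one contributes 0. It remains
  to see that no other exponent admits a positive limit, so that the description in
  \<open>multiplicity\<close> is unique.\<close>

theorem multiplicity_eq:
  fixes E :: "'v::finite \<Rightarrow> 'v \<Rightarrow> bool"
  shows "multiplicity TYPE('k::field) E
    = real (card {D. min_dominating E D \<and> card D = domination_number E})"
proof -
  let ?n = "CARD('v)" and ?\<gamma> = "domination_number E"
  let ?S = "\<lambda>d. \<Sum>i\<le>d. real (hilbert_fun TYPE('k) E i)"
  let ?e = "real (card {D. min_dominating E D \<and> card D = ?\<gamma>})"
  have "(\<lambda>d. \<Sum>D | dominating E D. fact (?n - ?\<gamma>) * real (d choose (?n - card D)) / real d ^ (?n - ?\<gamma>))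
     \<longlonglongrightarrow> (\<Sum>D | dominating E D. if card D = ?\<gamma> then 1 else 0)"
  proof (rule tendsto_sum)
    fix D assume "D \<in> {D. dominating E D}"
    \<comment> \<open>The bound by \<open>n\<close> keeps the natural-number subtraction exact, so a
      larger \<open>D\<close> gives a strictly smaller binomial index.\<close>
    then have "?\<gamma> \<le> card D" "card D \<le> ?n" using domination_number_le by (auto intro: card_mono)
    then have "card D = ?\<gamma> \<or> card D \<noteq> ?\<gamma> \<and> ?n - card D < ?n - ?\<gamma>" by auto
    then show "(\<lambda>d. fact (?n - ?\<gamma>) * real (d choose (?n - card D)) / real d ^ (?n - ?\<gamma>))
      \<longlonglongrightarrow> (if card D = ?\<gamma> then 1 else 0)"
      using tendsto_choose_div_power[of "?n - ?\<gamma>"]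
        tendsto_mult[OF tendsto_const[of "fact (?n - ?\<gamma>)"]
          tendsto_choose_div_power_less[of "?n - card D" "?n - ?\<gamma>"]]
      by (auto simp: mult.assoc)
  qed
  moreover have "(\<Sum>D | dominating E D. if card D = ?\<gamma> then 1 else 0) = ?e"
  proof -
    have "{D. min_dominating E D \<and> card D = ?\<gamma>} = {D. dominating E D} \<inter> {D. card D = ?\<gamma>}"
      using min_dominating_card_eq_iff by auto
    then show ?thesis by (simp add: sum.If_cases)
  qed
  moreover have "?S d = (\<Sum>D | dominating E D. real (d choose (?n - card D)))" for d
    using arg_cong[OF sum_hilbert_fun[where 'k='k, of E d], of real] by simp
  ultimately have lim: "(\<lambda>d. fact (?n - ?\<gamma>) * ?S d / real d ^ (?n - ?\<gamma>)) \<longlonglongrightarrow> ?e"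
    by (simp add: sum_distrib_left sum_divide_distrib)
  have "{D. min_dominating E D \<and> card D = ?\<gamma>} \<noteq> {}"
    using domination_number_attained[of E] min_dominating_card_eq_iff by blast
  then have pos: "?e > 0" by (simp add: card_gt_0_iff)
  \<comment> \<open>Passing from exponent \<open>a\<close> to a larger \<open>b\<close> multiplies
    the sequence by a constant and a null sequence, which contradicts \<open>y > 0\<close>.\<close>
  have less: False if "a < b" "x > 0" "y > 0"
    "(\<lambda>d. fact a * ?S d / real d ^ a) \<longlonglongrightarrow> x"
    "(\<lambda>d. fact b * ?S d / real d ^ b) \<longlonglongrightarrow> y" for a b :: nat and x y :: real
  proof -
    have "(\<lambda>d. 1 / real d ^ (b - a)) \<longlonglongrightarrow> 0"
      using \<open>a < b\<close> tendsto_power[OF lim_1_over_n, of "b - a"] by (simp add: power_divide zero_power)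
    then have "(\<lambda>d. (fact b / fact a) * ((fact a * ?S d / real d ^ a) * (1 / real d ^ (b - a))))
      \<longlonglongrightarrow> (fact b / fact a) * (x * 0)"
      by (intro tendsto_mult tendsto_const that)
    then have "(\<lambda>d. fact b * ?S d / real d ^ b) \<longlonglongrightarrow> 0"
      using \<open>a < b\<close> by (simp add: power_add[symmetric])
    then show False using LIMSEQ_unique that by fastforce
  qed
  show ?thesis
    unfolding multiplicity_def
  proof (rule the_equality)
    show "?e > 0 \<and> (\<exists>\<delta>. (\<lambda>d. fact \<delta> * ?S d / real d ^ \<delta>) \<longlonglongrightarrow> ?e)"
      using lim pos by blast
  next
    fix x assume "x > 0 \<and> (\<exists>\<delta>. (\<lambda>d. fact \<delta> * ?S d / real d ^ \<delta>) \<longlonglongrightarrow> x)"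
    then obtain \<delta> where x: "x > 0" "(\<lambda>d. fact \<delta> * ?S d / real d ^ \<delta>) \<longlonglongrightarrow> x" by blast
    have "\<not> \<delta> < ?n - ?\<gamma>" using less[OF _ x(1) pos x(2) lim] by blast
    moreover have "\<not> ?n - ?\<gamma> < \<delta>" using less[OF _ pos x(1) lim x(2)] by blast
    ultimately have "\<delta> = ?n - ?\<gamma>" by simp
    then show "x = ?e" using x lim LIMSEQ_unique by blast
  qed
qed

subsection \<open>Clique partitions and chordal graphs\<close>

text \<open>Simpliciality is taken in the subgraph induced on \<open>W\<close>, so that inductions
  can shrink \<open>W\<close> while the adjacency relation stays fixed.\<close>

definition simplicial_in :: "('v \<Rightarrow> 'v \<Rightarrow> bool) \<Rightarrow> 'v set \<Rightarrow> 'v \<Rightarrow> bool" where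
  "simplicial_in E W s \<longleftrightarrow> s \<in> W \<and> clique E (closed_nbhd E s \<inter> W)"

lemma mem_closed_nbhd [simp]: "w \<in> closed_nbhd E v \<longleftrightarrow> w = v \<or> E v w"
  by (simp add: closed_nbhd_def)

lemma clique_subset_closed_nbhd: "clique E C \<Longrightarrow> v \<in> C \<Longrightarrow> C \<subseteq> closed_nbhd E v"
  by (force simp: clique_def)

lemma cliqueI_closed_nbhd: "(\<And>v. v \<in> C \<Longrightarrow> C \<subseteq> closed_nbhd E v) \<Longrightarrow> clique E C"
  by (force simp: clique_def)

text \<open>A shortest walk from \<open>b\<close> to \<open>b'\<close> through \<open>A\<close> is an induced path, so together with \<open>v\<close>
  it would be a chordless cycle.\<close>
lemma chordal_link:
  assumes G: "simple_graph E" "chordal E"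
    and v: "E v b" "E v b'" "\<And>a. a \<in> A \<Longrightarrow> \<not> E v a \<and> a \<noteq> v"
    and walk: "successively E (b # ys @ [b'])" "set ys \<subseteq> A"
    and "b \<noteq> b'"
  shows "E b b'"
proof (rule ccontr)
  assume nE: "\<not> E b b'"
  have sym: "E x y \<longleftrightarrow> E y x" and irr: "\<not> E x x" for x y
    using G by (auto simp: simple_graph_def)
  \<comment> \<open>The ends \<open>b\<close> and \<open>b'\<close> are allowed inside the walk as
    well, so the class is closed under shortcuts; minimality later rules out repetitions.\<close>
  define P where "P p \<longleftrightarrow> p \<noteq> [] \<and> successively E p \<and> hd p = b \<and> last p = b' \<and> set p \<subseteq> A \<union> {b, b'}" for p
  have "P (b # ys @ [b'])" using walk by (auto simp: P_def)
  then obtain p where p: "P p" and min: "\<And>q. P q \<Longrightarrow> length p \<le> length q"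
    using ex_has_least_nat[of P _ length] by blast
  let ?n = "length p"
  have hd: "p ! 0 = b" and last: "p ! (?n - 1) = b'" and pne: "p \<noteq> []"
    using p by (auto simp: P_def hd_conv_nth last_conv_nth)
  have succ: "E (p ! i) (p ! Suc i)" if "Suc i < ?n" for i
    using p that by (auto simp: P_def successively_conv_nth)
  have cut: "j \<le> Suc i" if "i < j" "j < ?n" "p ! i = p ! j \<or> E (p ! i) (p ! j)" for i j
  proof (rule ccontr)
    assume "\<not> j \<le> Suc i"
    \<comment> \<open>When the two vertices coincide, the copy at \<open>i\<close> is dropped; when
      they are adjacent, both stay. Either way the walk gets shorter, because
      \<open>j > Suc i\<close>.\<close>
    let ?q = "take (if p ! i = p ! j then i else Suc i) p @ drop j p"
    have s: "successively E p" using p by (simp add: P_def)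
    have s1: "successively E (take k p)" and s2: "successively E (drop k p)" for k
      using s by (metis append_take_drop_id successively_append_iff)+
    have "successively E ?q"
    proof (cases "p ! i = p ! j")
      case True
      have "i = 0 \<or> E (last (take i p)) (p ! i)"
        using that succ[of "i - 1"] by (cases i) (auto simp: take_Suc_conv_app_nth)
      then show ?thesis
        using True that s1 s2 by (auto simp: successively_append_iff hd_drop_conv_nth)
    next
      case False
      moreover have "last (take (Suc i) p) = p ! i"
        using that by (simp add: take_Suc_conv_app_nth)
      ultimately show ?thesis
        using that s1 s2 by (auto simp: successively_append_iff hd_drop_conv_nth)
    qed
    moreover have "hd ?q = b"
      using hd that pne by (cases "i = 0") (auto simp: hd_append hd_drop_conv_nth hd_conv_nth)
    moreover have "last ?q = b'" using that p by (simp add: P_def last_drop)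
    moreover have "set ?q \<subseteq> A \<union> {b, b'}"
      using p set_take_subset set_drop_subset unfolding P_def by fastforce
    ultimately have "P ?q" using that by (auto simp: P_def)
    then have "?n \<le> length ?q" by (rule min)
    then show False using that \<open>\<not> j \<le> Suc i\<close> by (auto split: if_splits)
  qed
  have dist: "distinct p"
  proof (rule ccontr)
    assume "\<not> distinct p"
    then obtain i j where ij: "i < j" "j < ?n" "p ! i = p ! j"
      by (metis distinct_conv_nth linorder_neqE_nat)
    \<comment> \<open>\<open>cut\<close> still permits equal vertices at consecutive positions;
      irreflexivity excludes these.\<close>
    then have "j = Suc i" using cut by force
    moreover have "E (p ! i) (p ! Suc i)"
      using p ij calculation by (auto simp: P_def successively_conv_nth)
    ultimately show False using ij irr by metis
  qed
  have len: "?n \<ge> 3"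
  proof (rule ccontr)
    assume "\<not> ?n \<ge> 3"
    moreover have "?n \<noteq> 0" using pne by simp
    ultimately consider "?n = 1" | "?n = 2" by linarith
    then show False
    proof cases
      case 1 then show False using hd last \<open>b \<noteq> b'\<close> by simp
    next
      case 2 then show False using hd last nE succ[of 0] by simp
    qed
  qed
  have inner: "\<not> E v (p ! i)" if "0 < i" "i < ?n - 1" for i
  proof -
    have "p ! i \<in> set p" using that by simp
    then have "p ! i \<in> A \<union> {b, b'}" using p unfolding P_def by blast
    moreover have "p ! i \<noteq> p ! 0" "p ! i \<noteq> p ! (?n - 1)"
      using that pne by (simp_all add: nth_eq_iff_index_eq[OF dist])
    ultimately show ?thesis using v(3) hd last by auto
  qed
  have "v \<notin> A" "v \<noteq> b" "v \<noteq> b'" using v irr by auto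
  then have vp: "v \<notin> set p" using p unfolding P_def by blast
  let ?c = "v # p"
  have cyc: "E (?c ! i) (?c ! ((i + 1) mod length ?c))" if "i < length ?c" for i
  proof (cases "i = ?n")
    case True then show ?thesis using last v sym pne by (simp add: nth_Cons')
  next
    case False
    then have i: "i < ?n" using that by simp
    then show ?thesis
      using hd v succ[of "i - 1"] by (cases i) auto
  qed
  \<comment> \<open>Positions in \<open>?c\<close> are shifted by one against \<open>p\<close>. A
    chord at \<open>v\<close> would end at an inner vertex of \<open>p\<close>, against
    \<open>inner\<close>; a chord within \<open>p\<close> contradicts \<open>cut\<close>.\<close>
  have nochord: False
    if ch: "i < j" "j < length ?c" "j \<noteq> (i + 1) mod length ?c" "i \<noteq> (j + 1) mod length ?c"
      "E (?c ! i) (?c ! j)" for i j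
  proof (cases i)
    case 0
    then obtain j' where j': "j = Suc j'" using ch by (cases j) auto
    have "0 < j'" using that 0 j' len by (cases j') auto
    moreover have "j' < ?n - 1"
    proof (rule ccontr)
      assume "\<not> j' < ?n - 1"
      then have "j = ?n" using that j' by simp
      then show False using that 0 by simp
    qed
    ultimately show False using that 0 j' inner by simp
  next
    case (Suc i')
    then obtain j' where j': "j = Suc j'" using ch by (cases j) auto
    then have "i' < j'" "j' < ?n" "E (p ! i') (p ! j')" using that Suc by auto
    then have "j' = Suc i'" using cut by fastforce
    then show False using that Suc j' by simp
  qed
  have "distinct ?c \<and> length ?c \<ge> 4 \<and> (\<forall>i<length ?c. E (?c ! i) (?c ! ((i + 1) mod length ?c)))"
    using dist vp len cyc by simp
  then obtain i j where "i < length ?c" "j < length ?c" "i \<noteq> j" "j \<noteq> (i + 1) mod length ?c"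
      "i \<noteq> (j + 1) mod length ?c" "E (?c ! i) (?c ! j)"
    using G(2) unfolding chordal_def by blast
  then show False using nochord[of i j] nochord[of j i] sym by (metis linorder_neqE_nat)
qed

text \<open>Let \<open>A\<close> be a component of \<open>W - N[v]\<close>. Its boundary \<open>B\<close> is a clique of neighbours of \<open>v\<close>, so
  induction on \<open>A \<union> B\<close> gives a simplicial vertex inside \<open>A\<close>, where neighbourhoods within \<open>W\<close>
  and within \<open>A \<union> B\<close> coincide.\<close>
lemma chordal_simplicial_not_adjacent:
  fixes W :: "'v::finite set"
  assumes G: "simple_graph E" "chordal E" and "v \<in> W" "\<not> W \<subseteq> closed_nbhd E v"
  shows "\<exists>s. simplicial_in E W s \<and> s \<notin> closed_nbhd E v"
  using assms(3,4)
proof (induction "card W" arbitrary: W v rule: less_induct)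
  case less
  have sym: "E x y \<longleftrightarrow> E y x" and irr: "\<not> E x x" for x y
    using G by (auto simp: simple_graph_def)
  define R where "R x y \<longleftrightarrow> E x y \<and> x \<in> W - closed_nbhd E v \<and> y \<in> W - closed_nbhd E v" for x y
  obtain a where a: "a \<in> W - closed_nbhd E v" using less.prems by blast
  define A where "A = {y. R\<^sup>*\<^sup>* a y}"
  define B where "B = {b \<in> W - A. \<exists>x\<in>A. E x b}"
  have AW: "A \<subseteq> W - closed_nbhd E v"
  proof
    fix y assume "y \<in> A"
    then have "R\<^sup>*\<^sup>* a y" by (simp add: A_def)
    then show "y \<in> W - closed_nbhd E v" using a by (induction) (auto simp: R_def)
  qed
  have closed: "y \<in> A" if "x \<in> A" "E x y" "y \<in> W - closed_nbhd E v" for x y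
  proof -
    have "R x y" using that AW by (auto simp: R_def)
    then show ?thesis using that by (auto simp: A_def intro: rtranclp.rtrancl_into_rtrancl)
  qed
  have Bv: "E v b" if "b \<in> B" for b
    using that closed AW sym unfolding B_def by (fastforce)
  have symR: "symp R" using sym by (auto simp: symp_def R_def)
  have walk: "\<exists>ys. set ys \<subseteq> A \<and> successively E (x # ys) \<and> last (x # ys) = y" if "R\<^sup>*\<^sup>* x y" "x \<in> A" for x y
    using that
  proof (induction rule: converse_rtranclp_induct)
    case base
    show ?case by (rule exI[of _ "[]"]) simp
  next
    case (step x z)
    then have "z \<in> A" using closed by (auto simp: R_def)
    then obtain ys where "set ys \<subseteq> A" "successively E (z # ys)" "last (z # ys) = y"
      using step by blast
    then show ?case using step \<open>z \<in> A\<close> by (intro exI[of _ "z # ys"]) (auto simp: R_def)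
  qed
  have cB: "clique E B"
    unfolding clique_def
  proof (intro ballI impI)
    fix b b' assume b: "b \<in> B" "b' \<in> B" "b \<noteq> b'"
    then obtain x x' where x: "x \<in> A" "E x b" "x' \<in> A" "E x' b'" by (auto simp: B_def)
    have "R\<^sup>*\<^sup>* x x'"
      using x symp_rtranclp[OF symR] by (metis A_def mem_Collect_eq rtranclp_trans sympD)
    then obtain ys where ys: "set ys \<subseteq> A" "successively E (x # ys)" "last (x # ys) = x'"
      using walk x by blast
    have "successively E (b # (x # ys) @ [b'])"
      using ys x sym successively_append_iff[of E "x # ys" "[b']"] by auto
    then show "E b b'"
      using ys x b Bv AW by (intro chordal_link[OF G, of v b b' A "x # ys"]) auto
  qed
  have AB: "closed_nbhd E s \<inter> W = closed_nbhd E s \<inter> (A \<union> B)" if "s \<in> A" for s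
    using that AW by (auto simp: B_def)
  have "\<exists>s\<in>A. simplicial_in E (A \<union> B) s"
  \<comment> \<open>A vertex \<open>u\<close> of the first case takes the role of \<open>v\<close>
    in the induction: the simplicial vertex obtained avoids N[u], which contains \<open>B\<close>,
    and so lies in \<open>A\<close>.\<close>
  proof (cases "\<exists>u\<in>A \<union> B. B \<subseteq> closed_nbhd E u \<and> \<not> A \<union> B \<subseteq> closed_nbhd E u")
    case True
    then obtain u where u: "u \<in> A \<union> B" "B \<subseteq> closed_nbhd E u" "\<not> A \<union> B \<subseteq> closed_nbhd E u" by blast
    have "v \<notin> A \<union> B" using AW Bv irr by auto
    then have "A \<union> B \<subset> W" using AW less.prems by (auto simp: B_def)
    then have "card (A \<union> B) < card W" by (simp add: psubset_card_mono)
    then obtain s where "simplicial_in E (A \<union> B) s" "s \<notin> closed_nbhd E u"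
      using less.hyps u by blast
    then show ?thesis using u by (auto simp: simplicial_in_def)
  next
    case False
    \<comment> \<open>Being a clique, \<open>B\<close> lies in N[u] for each \<open>u\<close> in
      \<open>B\<close>, so each such \<open>u\<close> is joined to all of \<open>A\<close>. Hence
      the vertices of \<open>A\<close> also see all of \<open>B\<close>, and the failed case makes
      \<open>A \<union> B\<close> a clique.\<close>
    have BA: "A \<union> B \<subseteq> closed_nbhd E u" if "u \<in> B" for u
      using False that clique_subset_closed_nbhd[OF cB] by blast
    have "B \<subseteq> closed_nbhd E u" if "u \<in> A" for u
      using BA that sym by fastforce
    then have "clique E (A \<union> B)"
      using False BA by (intro cliqueI_closed_nbhd) blast
    moreover have "a \<in> A" by (simp add: A_def)
    ultimately show ?thesis by (auto simp: simplicial_in_def clique_def)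
  qed
  then obtain s where "s \<in> A" "simplicial_in E (A \<union> B) s" by blast
  then have "simplicial_in E W s" "s \<notin> closed_nbhd E v"
    using AW AB[of s] by (auto simp: simplicial_in_def simp del: mem_closed_nbhd)
  then show ?case by blast
qed

text \<open>If N[u] contains \<open>Q\<close> but not \<open>W\<close>, a simplicial vertex outside
  N[u] is as required. If there is no such \<open>u\<close>, then \<open>W\<close> is itself a
  clique and any vertex of \<open>W\<close> outside \<open>Q\<close> will do.\<close>

lemma chordal_simplicial_outside_clique:
  fixes W :: "'v::finite set"
  assumes G: "simple_graph E" "chordal E" and Q: "clique E Q" "Q \<subset> W"
  shows "\<exists>s. simplicial_in E W s \<and> s \<notin> Q"
proof (cases "\<exists>u\<in>W. Q \<subseteq> closed_nbhd E u \<and> \<not> W \<subseteq> closed_nbhd E u")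
  case True
  then show ?thesis using chordal_simplicial_not_adjacent[OF G] by blast
next
  case False
  have sym: "E x y \<longleftrightarrow> E y x" for x y using G by (auto simp: simple_graph_def)
  have QW: "W \<subseteq> closed_nbhd E u" if "u \<in> Q" for u
    using False that Q clique_subset_closed_nbhd[OF Q(1)] by blast
  have "Q \<subseteq> closed_nbhd E u" if "u \<in> W" for u
    using QW that sym by fastforce
  then have "clique E W"
    using False by (intro cliqueI_closed_nbhd) blast
  then show ?thesis using Q by (auto simp: simplicial_in_def clique_def)
qed

text \<open>Induction: remove a vertex \<open>s\<close> outside \<open>Q\<close> that is simplicial in \<open>W\<close>. If \<open>s\<close> has a neighbour
  outside \<open>Q\<close>, that neighbour dominates at least as much of \<open>Q\<close>; otherwise \<open>s\<close> may be put
  into \<open>X\<close> without any conflict.\<close>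
lemma chordal_clique_dominated_by_indep:
  fixes W :: "'v::finite set"
  assumes G: "simple_graph E" "chordal E" and "clique E Q" "Q \<subseteq> W"
    and "\<And>q. q \<in> Q \<Longrightarrow> \<exists>x\<in>W - Q. E q x"
  shows "\<exists>X \<subseteq> W - Q. indep_set E X \<and> (\<forall>q\<in>Q. \<exists>x\<in>X. E q x)"
  using assms(3-)
proof (induction "card W" arbitrary: W Q rule: less_induct)
  case less
  have sym: "E x y \<longleftrightarrow> E y x" and irr: "\<not> E x x" for x y
    using G by (auto simp: simple_graph_def)
  show ?case
  proof (cases "Q = W")
    case True
    then have "Q = {}" using less.prems(3) by auto
    then show ?thesis by (intro exI[of _ "{}"]) (auto simp: indep_set_def)
  next
    case False
    then obtain s where s: "s \<in> W" "s \<notin> Q" "clique E (closed_nbhd E s \<inter> W)"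
      using chordal_simplicial_outside_clique[OF G] less.prems(1,2)
      by (metis psubsetI simplicial_in_def)
    show ?thesis
    proof (cases "\<exists>t\<in>W - Q. E s t")
      case True
      then obtain t where t: "t \<in> W - Q" "E s t" by blast
      have "\<exists>x\<in>W - {s} - Q. E q x" if "q \<in> Q" for q
      proof (cases "E q s")
        case True
        then have "q \<in> closed_nbhd E s \<inter> W" "t \<in> closed_nbhd E s \<inter> W" "q \<noteq> t"
          using sym that less.prems(2) t by auto
        then have "E q t" using s(3) unfolding clique_def by blast
        then show ?thesis using t irr by auto
      next
        case False
        then show ?thesis using less.prems(3)[OF that] by blast
      qed
      moreover have "card (W - {s}) < card W" using s by (intro psubset_card_mono) auto
      ultimately obtain X where "X \<subseteq> W - {s} - Q" "indep_set E X" "\<forall>q\<in>Q. \<exists>x\<in>X. E q x"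
        using less.hyps[of "W - {s}" Q] less.prems s by auto
      then show ?thesis by blast
    next
      case False
      \<comment> \<open>The vertices of \<open>Q\<close> that \<open>s\<close> dominates are removed
        together with \<open>s\<close>. For the other vertices of \<open>Q\<close> the witness was
        never \<open>s\<close>, so the hypothesis survives.\<close>
      let ?K = "{q \<in> Q. E q s}"
      have "\<exists>x\<in>W - {s} - ?K - (Q - ?K). E q x" if "q \<in> Q - ?K" for q
        using less.prems(3)[of q] that by auto
      moreover have "card (W - {s} - ?K) < card W"
        using s by (intro psubset_card_mono) auto
      moreover have "clique E (Q - ?K)" using less.prems(1) by (auto simp: clique_def)
      moreover have "Q - ?K \<subseteq> W - {s} - ?K" using less.prems(2) s by auto
      ultimately obtain X where X: "X \<subseteq> W - {s} - ?K - (Q - ?K)" "indep_set E X"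
        "\<forall>q\<in>Q - ?K. \<exists>x\<in>X. E q x"
        using less.hyps[of "W - {s} - ?K" "Q - ?K"] by blast
      have "\<not> E s x \<and> \<not> E x s" if "x \<in> X" for x
        using that X(1) False sym[of x s] by auto
      then have "indep_set E (insert s X)"
        using X(2) irr by (auto simp: indep_set_def)
      then show ?thesis
        using X s by (intro exI[of _ "insert s X"]) auto
    qed
  qed
qed

section \<open>Simplicial vertices in well-covered graphs\<close>

lemma ex_max_indep_set:
  fixes X :: "'v::finite set"
  assumes "indep_set E X"
  shows "\<exists>I. max_indep_set E I \<and> X \<subseteq> I"
proof -
  have "finite {I. indep_set E I \<and> X \<subseteq> I}" by simp
  moreover have "X \<in> {I. indep_set E I \<and> X \<subseteq> I}" using assms by simp
  ultimately obtain I where I: "I \<in> {I. indep_set E I \<and> X \<subseteq> I}"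
    "\<And>J. J \<in> {I. indep_set E I \<and> X \<subseteq> I} \<Longrightarrow> I \<subseteq> J \<Longrightarrow> I = J"
    using finite_has_maximal2 by (metis (no_types, lifting))
  then have "max_indep_set E I" unfolding max_indep_set_def by blast
  then show ?thesis using I by blast
qed

lemma well_covered_card_le:
  fixes I :: "'v::finite set"
  assumes "well_covered E" "max_indep_set E I" "indep_set E J"
  shows "card J \<le> card I"
proof -
  obtain J' where "max_indep_set E J'" "J \<subseteq> J'" using ex_max_indep_set assms by blast
  then show ?thesis using assms by (metis card_mono finite well_covered_def)
qed

text \<open>Each closed neighborhood is a clique containing the center of the other, hence is
  contained in the other.\<close>

lemma simplicial_adjacent_closed_nbhd_eq:
  assumes "simple_graph E" "simplicial_in E UNIV s" "simplicial_in E UNIV t" "E s t"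
  shows "closed_nbhd E s = closed_nbhd E t"
proof
  have "t \<in> closed_nbhd E s" "s \<in> closed_nbhd E t" using assms by (auto simp: simple_graph_def)
  then show "closed_nbhd E s \<subseteq> closed_nbhd E t" "closed_nbhd E t \<subseteq> closed_nbhd E s"
    using assms clique_subset_closed_nbhd[of E "closed_nbhd E s" t]
      clique_subset_closed_nbhd[of E "closed_nbhd E t" s]
    by (simp_all only: simplicial_in_def Int_UNIV_right)
qed

text \<open>Otherwise \<open>s\<close> and \<open>t\<close> are distinct and nonadjacent. In a
  maximal independent set through \<open>v\<close>, no other vertex is adjacent to \<open>s\<close>
  or \<open>t\<close>, since it would then share a clique with \<open>v\<close>. Replacing
  \<open>v\<close> by \<open>s\<close> and \<open>t\<close> yields an independent set that is too
  large.\<close>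

lemma well_covered_simplices_disjoint:
  fixes E :: "'v::finite \<Rightarrow> 'v \<Rightarrow> bool"
  assumes G: "simple_graph E" "well_covered E"
    and st: "simplicial_in E UNIV s" "simplicial_in E UNIV t"
    and v: "v \<in> closed_nbhd E s" "v \<in> closed_nbhd E t"
  shows "closed_nbhd E s = closed_nbhd E t"
proof (rule ccontr)
  assume ne: "closed_nbhd E s \<noteq> closed_nbhd E t"
  have sym: "E x y \<longleftrightarrow> E y x" and irr: "\<not> E x x" for x y
    using G by (auto simp: simple_graph_def)
  have nst: "\<not> E s t" "s \<noteq> t"
    using simplicial_adjacent_closed_nbhd_eq[OF G(1) st] ne by auto
  then have v': "E s v" "E t v" "v \<noteq> s" "v \<noteq> t" using v sym by auto
  have "indep_set E {v}" using irr by (auto simp: indep_set_def)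
  then obtain I where I: "max_indep_set E I" "v \<in> I" using ex_max_indep_set by blast
  then have ind: "\<not> E x y" if "x \<in> I" "y \<in> I" for x y
    using that by (auto simp: max_indep_set_def indep_set_def)
  have "\<not> E u x \<and> \<not> E x u" if "x \<in> I - {v}" "simplicial_in E UNIV u" "E u v" for u x
  proof -
    have "E x v" if "E u x"
    proof -
      have "x \<in> closed_nbhd E u" "v \<in> closed_nbhd E u" "x \<noteq> v"
        using that \<open>E u v\<close> \<open>x \<in> I - {v}\<close> by auto
      then show ?thesis using \<open>simplicial_in E UNIV u\<close> unfolding simplicial_in_def clique_def by blast
    qed
    then show ?thesis using ind[OF _ I(2)] sym[of x u] \<open>x \<in> I - {v}\<close> by blast
  qed
  then have "\<not> E s x \<and> \<not> E x s" "\<not> E t x \<and> \<not> E x t" if "x \<in> I - {v}" for x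
    using that st v' by auto
  moreover have "\<not> E t s" using nst sym by blast
  ultimately have "indep_set E (insert s (insert t (I - {v})))"
    using ind nst irr by (auto simp: indep_set_def)
  then have "card (insert s (insert t (I - {v}))) \<le> card I"
    using well_covered_card_le[OF G(2) I(1)] by blast
  moreover have "s \<notin> I" "t \<notin> I" using ind I(2) v' by auto
  ultimately show False using nst I(2) card_gt_0_iff[of I] by (auto simp: card_Diff_singleton)
qed

lemma well_covered_chordal_simplices_cover:
  fixes E :: "'v::finite \<Rightarrow> 'v \<Rightarrow> bool"
  assumes G: "simple_graph E" "chordal E" "well_covered E"
  shows "\<exists>s. simplicial_in E UNIV s \<and> v \<in> closed_nbhd E s"
proof (rule ccontr)
  assume v: "\<not> ?thesis"
  have sym: "E x y \<longleftrightarrow> E y x" and irr: "\<not> E x x" for x y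
    using G by (auto simp: simple_graph_def)
  define U where "U = (\<Union>s\<in>{s. simplicial_in E UNIV s}. closed_nbhd E s)"
  define \<C> where "\<C> = closed_nbhd E ` {s. simplicial_in E UNIV s}"
  \<comment> \<open>The empty clique serves to obtain some simplicial vertex \<open>w\<close> of the
    subgraph induced on the uncovered vertices.\<close>
  have "clique E {}" by (simp add: clique_def)
  moreover have "v \<in> - U" using v by (auto simp: U_def)
  then have "{} \<subset> - U" by blast
  ultimately obtain w where w: "w \<notin> U" "clique E (closed_nbhd E w - U)"
    using chordal_simplicial_outside_clique[OF G(1,2), of "{}" "- U"]
    by (auto simp: simplicial_in_def Diff_eq)
  let ?Q = "closed_nbhd E w - U"
  \<comment> \<open>If all neighbors of \<open>q\<close> were in the clique \<open>?Q\<close>, then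
    \<open>q\<close> would be simplicial in the whole graph, hence covered.\<close>
  have "\<exists>x\<in>UNIV - ?Q. E q x" if "q \<in> ?Q" for q
  proof (rule ccontr)
    assume "\<not> ?thesis"
    then have "closed_nbhd E q \<subseteq> ?Q" using that by auto
    then have "simplicial_in E UNIV q" using w(2) by (auto simp: simplicial_in_def clique_def)
    then show False using that by (auto simp: U_def)
  qed
  then obtain X where X: "X \<subseteq> UNIV - ?Q" "indep_set E X" "\<forall>q\<in>?Q. \<exists>x\<in>X. E q x"
    using chordal_clique_dominated_by_indep[OF G(1,2) w(2), of UNIV] by auto
  obtain I where I: "max_indep_set E I" "X \<subseteq> I" using ex_max_indep_set X by blast
  then have ind: "\<not> E x y" if "x \<in> I" "y \<in> I" for x y
    using that by (auto simp: max_indep_set_def indep_set_def)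
  \<comment> \<open>Since \<open>X\<close> dominates \<open>?Q\<close>, so does \<open>I\<close>;
    this is what lets \<open>w\<close> be added to \<open>I - U\<close>.\<close>
  have IQ: "I \<inter> ?Q = {}" using X(3) I(2) ind by blast
  \<comment> \<open>Several simplicial vertices may share one closed neighborhood, so one
    representative is chosen per clique.\<close>
  define r where "r C = (SOME s. simplicial_in E UNIV s \<and> closed_nbhd E s = C)" for C
  have r: "simplicial_in E UNIV (r C)" "closed_nbhd E (r C) = C" if "C \<in> \<C>" for C
    using that someI_ex[of "\<lambda>s. simplicial_in E UNIV s \<and> closed_nbhd E s = C"]
    unfolding r_def \<C>_def by auto
  have rinj: "inj_on r \<C>" by (rule inj_onI) (metis r(2))
  define R where "R = r ` \<C>"
  have rU: "R \<subseteq> U" using r(1) unfolding R_def U_def by force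
  let ?J = "insert w (I - U) \<union> R"
  have "indep_set E ?J"
  proof -
    have 1: "\<not> E w x" "\<not> E x w" if "x \<in> I - U" for x
      using that IQ sym by auto
    \<comment> \<open>All neighbors of a simplicial vertex are covered.\<close>
    have 2: "\<not> E x y" "\<not> E y x" if "x \<in> R" "y \<notin> U" for x y
    proof -
      have "simplicial_in E UNIV x" using that(1) r(1) unfolding R_def by blast
      then have "closed_nbhd E x \<subseteq> U" unfolding U_def by blast
      then have "\<not> E x y" using that(2) by auto
      then show "\<not> E x y" "\<not> E y x" using sym[of x y] by simp_all
    qed
    have 3: "\<not> E x y" if xy: "x \<in> R" "y \<in> R" for x y
    proof
      assume E: "E x y"
      obtain C C' where C: "C \<in> \<C>" "C' \<in> \<C>" "x = r C" "y = r C'" using xy unfolding R_def by blast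
      then have "C = C'" using simplicial_adjacent_closed_nbhd_eq[OF G(1)] r E by metis
      then show False using E irr C by simp
    qed
    show ?thesis
      unfolding indep_set_def
    proof (intro ballI)
      fix x y assume "x \<in> ?J" "y \<in> ?J"
      then have "x = w \<or> x \<in> I - U \<or> x \<in> R" "y = w \<or> y \<in> I - U \<or> y \<in> R" by auto
      then show "\<not> E x y"
        by (elim disjE) (use 1 2 3 ind irr w(1) in simp_all)
    qed
  qed
  then have "card ?J \<le> card I" using well_covered_card_le[OF G(3) I(1)] by blast
  moreover have "card ?J = card (insert w (I - U)) + card \<C>"
    using rU w(1) card_image[OF rinj] by (subst card_Un_disjoint) (auto simp: R_def)
  moreover have "w \<notin> I" using IQ w(1) by auto
  moreover have "card I = card (I - U) + card (I \<inter> U)"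
    by (subst card_Un_disjoint[symmetric]) (auto intro: arg_cong[of _ _ card])
  \<comment> \<open>Each covered vertex of \<open>I\<close> is sent to a clique containing it; a
    clique meets an independent set at most once, so this map is injective. Hence \<open>?J\<close>
    has at least one vertex more than \<open>I\<close>.\<close>
  moreover have "card (I \<inter> U) \<le> card \<C>"
  proof (rule card_inj_on_le)
    define k where "k x = (SOME C. C \<in> \<C> \<and> x \<in> C)" for x
    have k: "k x \<in> \<C>" "x \<in> k x" if "x \<in> U" for x
      using that someI_ex[of "\<lambda>C. C \<in> \<C> \<and> x \<in> C"] unfolding k_def \<C>_def U_def by auto
    show "inj_on k (I \<inter> U)"
    proof (rule inj_onI)
      fix x y assume xy: "x \<in> I \<inter> U" "y \<in> I \<inter> U" "k x = k y"
      then have kx: "k x \<in> \<C>" "x \<in> k x" "y \<in> k x"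
        using k(1)[of x] k(2)[of x] k(2)[of y] by auto
      then have "clique E (k x)" unfolding \<C>_def simplicial_in_def by auto
      then show "x = y" using kx ind xy unfolding clique_def by blast
    qed
    show "k ` (I \<inter> U) \<subseteq> \<C>" using k by auto
  qed simp
  ultimately show False by simp
qed

section \<open>Free vertices and maximal cliques\<close>

lemma max_clique_closed_nbhd:
  assumes "simplicial_in E UNIV s"
  shows "max_clique E C \<and> s \<in> C \<longleftrightarrow> C = closed_nbhd E s"
proof -
  have c: "clique E (closed_nbhd E s)" using assms by (simp add: simplicial_in_def)
  have sub: "C \<subseteq> closed_nbhd E s" if "clique E C" "s \<in> C" for C
    by (rule clique_subset_closed_nbhd[OF that])
  show ?thesis
  proof
    assume "max_clique E C \<and> s \<in> C"
    then show "C = closed_nbhd E s" using c sub[of C] unfolding max_clique_def by blast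
  next
    assume C: "C = closed_nbhd E s"
    have "C' = C" if "clique E C'" "C \<subseteq> C'" for C'
      using sub[OF that(1)] that(2) C by auto
    then show "max_clique E C \<and> s \<in> C" using c C by (simp add: max_clique_def)
  qed
qed

text \<open>A simplicial vertex lies in its closed neighborhood and in no other maximal clique. The
  set \<open>A\<close> allows a choice of simplicial vertices: all of them for chordal graphs, those
  of degree one for whisker graphs.\<close>

lemma simplices_free_max_cliques:
  assumes \<C>: "\<C> = closed_nbhd E ` {s \<in> A. simplicial_in E UNIV s}"
  shows "\<forall>C\<in>\<C>. max_clique E C \<and> (\<exists>v\<in>C. free_vertex E v)"
proof
  fix C assume "C \<in> \<C>"
  then obtain s where s: "simplicial_in E UNIV s" "C = closed_nbhd E s" using \<C> by blast
  then have "max_clique E C' \<and> s \<in> C' \<longleftrightarrow> C' = C" for C'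
    using max_clique_closed_nbhd[OF s(1)] by simp
  then have "max_clique E C" "s \<in> C" "free_vertex E s"
    unfolding free_vertex_def by auto
  then show "max_clique E C \<and> (\<exists>v\<in>C. free_vertex E v)" by blast
qed

text \<open>Every edge at \<open>v\<close> extends to a maximal clique, which must be
  \<open>C\<close> because \<open>v\<close> is free.\<close>

lemma free_vertex_closed_nbhd:
  fixes E :: "'v::finite \<Rightarrow> 'v \<Rightarrow> bool"
  assumes G: "simple_graph E" and C: "max_clique E C" "v \<in> C" "free_vertex E v"
  shows "closed_nbhd E v = C"
proof
  show "C \<subseteq> closed_nbhd E v" using clique_subset_closed_nbhd[of E C v] C(1,2) by (simp add: max_clique_def)
  show "closed_nbhd E v \<subseteq> C"
  proof
    fix w assume "w \<in> closed_nbhd E v"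
    then have "clique E {v, w}" using G by (auto simp: clique_def simple_graph_def)
    moreover have "finite {D. clique E D}" by simp
    ultimately obtain D where D: "clique E D" "{v, w} \<subseteq> D" "\<And>D'. clique E D' \<Longrightarrow> D \<subseteq> D' \<Longrightarrow> D = D'"
      using finite_has_maximal2[of "{D. clique E D}" "{v, w}"] by auto
    then have "max_clique E D" by (auto simp: max_clique_def)
    then have "D = C" using C D(2) by (auto simp: free_vertex_def)
    then show "w \<in> C" using D(2) by blast
  qed
qed

section \<open>Minimal dominating sets as transversals\<close>

text \<open>Each part is the closed neighborhood of a free vertex, and each closed neighborhood
  contains the part of its center, so dominating means meeting every part. The minimal such sets
  correspond bijectively to the choice functions on the partition.\<close>

lemma clique_partition_min_dominating:
  fixes E :: "'v::finite \<Rightarrow> 'v \<Rightarrow> bool"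
  assumes G: "simple_graph E" and cov: "\<Union>\<C> = UNIV"
    and disj: "\<forall>C\<in>\<C>. \<forall>C'\<in>\<C>. C \<noteq> C' \<longrightarrow> C \<inter> C' = {}"
    and free: "\<forall>C\<in>\<C>. max_clique E C \<and> (\<exists>v\<in>C. free_vertex E v)"
  shows "well_dominated E" "num_min_dom E = (\<Prod>C\<in>\<C>. card C)"
proof -
  have dom: "dominating E D \<longleftrightarrow> (\<forall>C\<in>\<C>. D \<inter> C \<noteq> {})" for D
  proof
    assume D: "dominating E D"
    show "\<forall>C\<in>\<C>. D \<inter> C \<noteq> {}"
    proof
      fix C assume "C \<in> \<C>"
      then obtain v where "max_clique E C" "v \<in> C" "free_vertex E v" using free by blast
      then have "closed_nbhd E v = C" by (rule free_vertex_closed_nbhd[OF G])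
      then show "D \<inter> C \<noteq> {}" using D unfolding dominating_def by blast
    qed
  next
    assume D: "\<forall>C\<in>\<C>. D \<inter> C \<noteq> {}"
    show "dominating E D"
      unfolding dominating_def
    proof
      fix v
      have "v \<in> \<Union>\<C>" using cov by simp
      then obtain C where C: "C \<in> \<C>" "v \<in> C" by blast
      then have "clique E C" using free by (simp add: max_clique_def)
      then have "C \<subseteq> closed_nbhd E v" using C(2) by (rule clique_subset_closed_nbhd)
      then show "D \<inter> closed_nbhd E v \<noteq> {}" using D C by blast
    qed
  qed
  let ?T = "PiE \<C> (\<lambda>C. C)"
  \<comment> \<open>A transversal meets each part exactly once; injectivity of the correspondence
    and minimality both rest on this.\<close>
  have Tim: "f ` \<C> \<inter> C = {f C}" if "f \<in> ?T" "C \<in> \<C>" for f C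
  proof
    have f: "f C' \<in> C'" if "C' \<in> \<C>" for C' using that \<open>f \<in> ?T\<close> by (rule PiE_mem[rotated])
    show "{f C} \<subseteq> f ` \<C> \<inter> C" using f[OF that(2)] that(2) by blast
    show "f ` \<C> \<inter> C \<subseteq> {f C}"
    proof
      fix x assume "x \<in> f ` \<C> \<inter> C"
      then obtain C' where C': "C' \<in> \<C>" "x = f C'" "x \<in> C" by blast
      then have "x \<in> C' \<inter> C" using f by simp
      then have "C' = C" using disj C'(1) that(2) by blast
      then show "x \<in> {f C}" using C' by simp
    qed
  qed
  have injT: "inj_on (\<lambda>f. f ` \<C>) ?T"
  proof (rule inj_onI)
    fix f g assume fg: "f \<in> ?T" "g \<in> ?T" "f ` \<C> = g ` \<C>"
    show "f = g"
    proof (rule PiE_ext[OF fg(1,2)])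
      fix C assume C: "C \<in> \<C>"
      have "{f C} = {g C}"
        by (simp only: Tim[OF fg(1) C, symmetric] Tim[OF fg(2) C, symmetric] fg(3))
      then show "f C = g C" by simp
    qed
  qed
  have injf: "inj_on f \<C>" if f: "f \<in> ?T" for f
  proof (rule inj_onI)
    fix C C' assume CC: "C \<in> \<C>" "C' \<in> \<C>" "f C = f C'"
    have "f C \<in> C" "f C \<in> C'"
      using PiE_mem[OF f CC(1)] PiE_mem[OF f CC(2)] CC(3) by simp_all
    then show "C = C'" using disj CC by blast
  qed
  have eq: "{D. min_dominating E D} = (\<lambda>f. f ` \<C>) ` ?T"
  proof (intro equalityI subsetI)
    fix D assume "D \<in> {D. min_dominating E D}"
    then have D: "dominating E D" "\<And>D'. dominating E D' \<Longrightarrow> D' \<subseteq> D \<Longrightarrow> D' = D"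
      by (auto simp: min_dominating_def)
    define f where "f = (\<lambda>C\<in>\<C>. SOME x. x \<in> D \<inter> C)"
    have f: "f C \<in> D \<inter> C" if "C \<in> \<C>" for C
    proof -
      have "\<exists>x. x \<in> D \<inter> C" using D(1) that unfolding dom by blast
      moreover have "f C = (SOME x. x \<in> D \<inter> C)" using that by (simp add: f_def)
      ultimately show ?thesis using someI_ex[of "\<lambda>x. x \<in> D \<inter> C"] by metis
    qed
    moreover have "f \<in> extensional \<C>" by (simp add: f_def)
    ultimately have "f \<in> ?T" by (simp add: PiE_def Pi_def)
    \<comment> \<open>The chosen points already form a dominating subset of the minimal set
      \<open>D\<close>.\<close>
    moreover have "f ` \<C> = D"
    proof (rule D(2))
      show "dominating E (f ` \<C>)" unfolding dom using f by blast
    qed (use f in blast)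
    ultimately show "D \<in> (\<lambda>f. f ` \<C>) ` ?T" by blast
  next
    fix D assume "D \<in> (\<lambda>f. f ` \<C>) ` ?T"
    then obtain f where f: "f \<in> ?T" "D = f ` \<C>" by blast
    have "\<not> dominating E D'" if sub: "D' \<subset> D" for D'
    proof -
      obtain C where C: "C \<in> \<C>" "f C \<notin> D'" using sub f(2) by blast
      have "D' \<inter> C \<subseteq> {f C}"
        unfolding Tim[OF f(1) C(1), symmetric] using sub f(2) by auto
      then have "D' \<inter> C = {}" using C(2) by blast
      then show ?thesis using C by (auto simp: dom)
    qed
    moreover have "dominating E D" unfolding dom using Tim[OF f(1)] f(2) by simp
    ultimately show "D \<in> {D. min_dominating E D}" by (simp add: min_dominating_def)
  qed
  have "card D = card \<C>" if "min_dominating E D" for D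
  proof -
    have "D \<in> (\<lambda>f. f ` \<C>) ` ?T" using that by (simp flip: eq)
    then show ?thesis using card_image[OF injf] by blast
  qed
  then show "well_dominated E" by (simp add: well_dominated_def)
  show "num_min_dom E = (\<Prod>C\<in>\<C>. card C)"
    unfolding num_min_dom_def eq using injT by (simp add: card_image card_PiE)
qed

section \<open>Partitions for well-covered chordal graphs and whisker graphs\<close>

lemma well_covered_chordal_partition:
  fixes E :: "'v::finite \<Rightarrow> 'v \<Rightarrow> bool"
  assumes "simple_graph E" "chordal E" "well_covered E"
  shows "\<exists>\<C>. \<Union>\<C> = UNIV \<and> (\<forall>C\<in>\<C>. \<forall>C'\<in>\<C>. C \<noteq> C' \<longrightarrow> C \<inter> C' = {})
    \<and> (\<forall>C\<in>\<C>. max_clique E C \<and> (\<exists>v\<in>C. free_vertex E v))"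
proof (intro exI conjI)
  let ?C = "closed_nbhd E ` {s \<in> UNIV. simplicial_in E UNIV s}"
  show "\<Union>?C = UNIV" using well_covered_chordal_simplices_cover[OF assms] by auto
  show "\<forall>C\<in>?C. \<forall>C'\<in>?C. C \<noteq> C' \<longrightarrow> C \<inter> C' = {}"
    using well_covered_simplices_disjoint[OF assms(1,3)] by blast
  show "\<forall>C\<in>?C. max_clique E C \<and> (\<exists>v\<in>C. free_vertex E v)"
    by (rule simplices_free_max_cliques[OF refl])
qed

text \<open>The parts are the closed neighborhoods of the vertices of degree one, which are single
  edges. Every vertex either has degree one or is adjacent to such a vertex.\<close>

lemma whisker_graph_partition:
  fixes E :: "'v::finite \<Rightarrow> 'v \<Rightarrow> bool"
  assumes G: "simple_graph E" and wh: "whisker_graph E"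
  shows "\<exists>\<C>. \<Union>\<C> = UNIV \<and> (\<forall>C\<in>\<C>. \<forall>C'\<in>\<C>. C \<noteq> C' \<longrightarrow> C \<inter> C' = {})
    \<and> (\<forall>C\<in>\<C>. max_clique E C \<and> (\<exists>v\<in>C. free_vertex E v))"
proof (intro exI conjI)
  have sym: "E x y \<longleftrightarrow> E y x" and irr: "\<not> E x x" for x y
    using G by (auto simp: simple_graph_def)
  have leaf: "\<exists>w. closed_nbhd E s = {s, w} \<and> E s w \<and> (\<forall>x. E s x \<longrightarrow> x = w)" if deg: "degree E s = 1" for s
  proof -
    have "card {x. E s x} = 1" using deg by (simp add: degree_def)
    then obtain w where "{x. E s x} = {w}" by (rule card_1_singletonE)
    then show ?thesis by (auto simp: closed_nbhd_def)
  qed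
  have simp: "simplicial_in E UNIV s" if "degree E s = 1" for s
    using leaf[OF that] sym by (auto simp: simplicial_in_def clique_def)
  let ?C = "closed_nbhd E ` {s \<in> {s. degree E s = 1}. simplicial_in E UNIV s}"
  show "\<forall>C\<in>?C. max_clique E C \<and> (\<exists>v\<in>C. free_vertex E v)"
    by (rule simplices_free_max_cliques[OF refl])
  show "\<Union>?C = UNIV"
  proof (intro equalityI subsetI UNIV_I)
    fix v
    have "\<exists>s. degree E s = 1 \<and> v \<in> closed_nbhd E s"
      using wh sym unfolding whisker_graph_def by (metis mem_closed_nbhd)
    then show "v \<in> \<Union>?C" using simp by blast
  qed
  have eq: "closed_nbhd E s = closed_nbhd E t"
    if st: "degree E s = 1" "degree E t = 1" and v: "v \<in> closed_nbhd E s" "v \<in> closed_nbhd E t" for s t v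
  \<comment> \<open>Two adjacent vertices of degree one span the same part. If they are distinct and
    nonadjacent, \<open>v\<close> is adjacent to both, against the uniqueness of its neighbor of
    degree one.\<close>
  proof (cases "E s t \<or> s = t")
    case True
    then show ?thesis using simplicial_adjacent_closed_nbhd_eq[OF G] simp st by blast
  next
    case False
    then have v': "E v s" "E v t" using v sym by auto
    then have "degree E v \<noteq> 1" using leaf[of v] False by auto
    then show ?thesis using wh v' st unfolding whisker_graph_def by metis
  qed
  then show "\<forall>C\<in>?C. \<forall>C'\<in>?C. C \<noteq> C' \<longrightarrow> C \<inter> C' = {}" by blast
qed

section \<open>Multiplicity compared with the number of minimal dominating sets\<close>

theorem theorem3p11:
  fixes E :: "'v::finite \<Rightarrow> 'v \<Rightarrow> bool"
  assumes "simple_graph E"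
  shows
   "multiplicity TYPE('k::field) E
      = real (card {D. min_dominating E D \<and> card D = domination_number E})
    \<and> multiplicity TYPE('k) E \<le> real (num_min_dom E)
    \<and> (multiplicity TYPE('k) E = real (num_min_dom E) \<longleftrightarrow> well_dominated E)
    \<and> (\<forall>\<C> :: 'v set set.
          \<Union>\<C> = UNIV \<and> (\<forall>C\<in>\<C>. \<forall>C'\<in>\<C>. C \<noteq> C' \<longrightarrow> C \<inter> C' = {})
          \<and> (\<forall>C\<in>\<C>. max_clique E C \<and> (\<exists>v\<in>C. free_vertex E v))
        \<longrightarrow> multiplicity TYPE('k) E = real (num_min_dom E)
            \<and> num_min_dom E = (\<Prod>C\<in>\<C>. card C))
    \<and> ((well_covered E \<and> chordal E) \<or> whisker_graph E \<longrightarrow>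
        (\<exists>\<C> :: 'v set set.
          \<Union>\<C> = UNIV \<and> (\<forall>C\<in>\<C>. \<forall>C'\<in>\<C>. C \<noteq> C' \<longrightarrow> C \<inter> C' = {})
          \<and> (\<forall>C\<in>\<C>. max_clique E C \<and> (\<exists>v\<in>C. free_vertex E v))
          \<and> multiplicity TYPE('k) E = real (num_min_dom E)
          \<and> num_min_dom E = (\<Prod>C\<in>\<C>. card C)))"
proof -
  let ?M = "{D. min_dominating E D}" and ?m = "multiplicity TYPE('k) E"
  let ?N = "{D. min_dominating E D \<and> card D = domination_number E}"
  have mult: "?m = real (card ?N)" by (rule multiplicity_eq)
  have le: "?m \<le> real (num_min_dom E)"
    unfolding mult num_min_dom_def by (auto intro: card_mono)
  have iff: "?m = real (num_min_dom E) \<longleftrightarrow> well_dominated E"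
  proof
    assume "?m = real (num_min_dom E)"
    then have "card ?N = card ?M" by (simp add: mult num_min_dom_def)
    then have "?N = ?M" by (intro card_subset_eq) auto
    then have "card D = domination_number E" if "min_dominating E D" for D
      using that by auto
    then show "well_dominated E" by (simp add: well_dominated_def)
  next
    assume wd: "well_dominated E"
    \<comment> \<open>A dominating set of minimum size is minimal, so the common size of all minimal
      ones is the domination number.\<close>
    obtain D where D: "min_dominating E D" "card D = domination_number E"
      using domination_number_attained[of E] min_dominating_card_eq_iff by blast
    have "card D' = domination_number E" if "min_dominating E D'" for D'
      using wd D that unfolding well_dominated_def by metis
    then have "?N = ?M" by blast
    then show "?m = real (num_min_dom E)" by (simp add: mult num_min_dom_def)
  qed
  \<comment> \<open>A clique partition makes the graph well-dominated; \<open>iff\<close> then turns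
    this into the equality for the multiplicity.\<close>
  note part = clique_partition_min_dominating[OF assms]
  have ex: "\<exists>\<C> :: 'v set set. \<Union>\<C> = UNIV
      \<and> (\<forall>C\<in>\<C>. \<forall>C'\<in>\<C>. C \<noteq> C' \<longrightarrow> C \<inter> C' = {})
      \<and> (\<forall>C\<in>\<C>. max_clique E C \<and> (\<exists>v\<in>C. free_vertex E v))"
    if "(well_covered E \<and> chordal E) \<or> whisker_graph E"
    using that well_covered_chordal_partition[OF assms] whisker_graph_partition[OF assms] by blast
  show ?thesis
  proof (intro conjI allI impI)
    assume "(well_covered E \<and> chordal E) \<or> whisker_graph E"
    from ex[OF this] obtain \<C> :: "'v set set" where C: "\<Union>\<C> = UNIV"
      "\<forall>C\<in>\<C>. \<forall>C'\<in>\<C>. C \<noteq> C' \<longrightarrow> C \<inter> C' = {}"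
      "\<forall>C\<in>\<C>. max_clique E C \<and> (\<exists>v\<in>C. free_vertex E v)" by (elim exE conjE)
    then show "\<exists>\<C> :: 'v set set. \<Union>\<C> = UNIV
      \<and> (\<forall>C\<in>\<C>. \<forall>C'\<in>\<C>. C \<noteq> C' \<longrightarrow> C \<inter> C' = {})
      \<and> (\<forall>C\<in>\<C>. max_clique E C \<and> (\<exists>v\<in>C. free_vertex E v))
      \<and> ?m = real (num_min_dom E) \<and> num_min_dom E = (\<Prod>C\<in>\<C>. card C)"
      using part(2)[OF C] part(1)[OF C, folded iff] by (intro exI[of _ \<C>] conjI)
  next
    fix \<C> :: "'v set set"
    assume C: "\<Union>\<C> = UNIV \<and> (\<forall>C\<in>\<C>. \<forall>C'\<in>\<C>. C \<noteq> C' \<longrightarrow> C \<inter> C' = {})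
      \<and> (\<forall>C\<in>\<C>. max_clique E C \<and> (\<exists>v\<in>C. free_vertex E v))"
    show "?m = real (num_min_dom E)"
      using part(1)[OF conjunct1[OF C] conjunct1[OF conjunct2[OF C]] conjunct2[OF conjunct2[OF C]]]
      by (simp only: iff)
    show "num_min_dom E = (\<Prod>C\<in>\<C>. card C)"
      by (rule part(2)[OF conjunct1[OF C] conjunct1[OF conjunct2[OF C]] conjunct2[OF conjunct2[OF C]]])
  qed (fact mult le iff)+
qed

end
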